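(* Let $A=\operatorname{diag}(\lambda_1,\dots,\lambda_n)$, let $q$ be a polynomial with $q(\lambda_i)\ne0$ for every $i$, write $|q(\lambda_i)|^2=a_i=e^{\eta_i}$, let $p$ be the spectral weight vector of a unit vector and $p^{(q)}$ the weight vector of the filtered vector. For small $\eta=(\eta_1,\dots,\eta_n)$, \[ p_i^{(q)}-p_i=p_i(\eta_i-\overline\eta_p)+O(\|\eta\|^2),\qquad \overline\eta_p=\sum_jp_j\eta_j . \] Consequently, if $U$ denotes the unstable subspace of the active-support linearization in probability coordinates, then the unstable coordinate injected by the filter is \[ P_U\bigl(p^{(q)}-p\bigr)=P_U\left(p_i(\eta_i-\overline\eta_p)\right)_{i=1}^n+O(\|\eta\|^2). \] Let $b_q=P_U(p^{(q)}-p)$ and let $\gamma_{\min}$ be the smallest positive active escape rate. In the linearized active model, the time $T_{\rm esc}^q$ to reach an unstable-coordinate threshold $\delta>\|b_q\|$ satisfies \[ T_{\rm esc}^q\le\frac1{\gamma_{\min}}\log\frac{\delta}{\|b_q\|}, \] provided $b_q\ne0$, with the norm chosen in the self-adjoint active coordinates.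
   Context: For a unit vector $u$ the spectral weights are $p_i=|u_i|^2$; the filtered vector is $v=q(A)u/\|q(A)u\|$ and $p_i^{(q)}=|v_i|^2=a_ip_i/\sum_ja_jp_j$. The eigenvalues are pairwise distinct and a critical torus $C(p^* )$ of $\rho_A(u)=\|Au-(u^*Au)u\|^2$ is fixed: $p^*$ is a probability vector with active set $S=\{i:p_i^*>0\}$ such that, with $c=\sum_ip_i^*\lambda_i$ and $q_i=\lambda_i-c$, all $|q_i|$, $i\in S$, are equal. The active-support linearization is the linearization at $p^*$ of the residual flow $\dot p_i=4p_i(\rho(p)-|\lambda_i-z(p)|^2)$ (with $z(p)=\sum_jp_j\lambda_j$, $\rho(p)=\sum_jp_j|\lambda_j-z(p)|^2$) in the active weights: $L_S$ acts on $V_S=\{a\in\mathbb R^S:\sum_{i\in S}a_i=0\}$ by $(L_Sa)_i=8p_i^*\operatorname{Re}(q_i\overline{\delta z})$, $\delta z=\sum_{i\in S}a_iq_i$. It is self-adjoint for the inner product $\langle a,b\rangle_*=\sum_{i\in S}a_ib_i/p_i^*$. $U\subset V_S$ is the span of the eigenvectors of $L_S$ with positive eigenvalues (the active escape rates), and $P_U$ is the $\langle\cdot,\cdot\rangle_*$-orthogonal projection onto $U$, applied to the coordinates in $S$. The norm in the escape estimate is $\|a\|=\langle a,a\rangle_*^{1/2}$. In the linearized active model the unstable coordinate $x(t)\in U$ evolves by $\dot x=L_Sx$ with $x(0)=b_q$, and $T^q_{\rm esc}$ is the first time at which $\|x(t)\|=\delta$. *)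

theory Defs
  imports "HOL-Analysis.Analysis" "HOL-Computational_Algebra.Polynomial"
begin

section \<open>Polynomial filters of a diagonal matrix\<close>

definition diag_mat :: "complex ^ 'n \<Rightarrow> complex ^ 'n ^ 'n" where
  "diag_mat lam = (\<chi> i j. if i = j then lam $ i else 0)"

(* The power operation that type vec inherits from its ring instance is componentwise,
   so powers with respect to the matrix product are defined here. *)
primrec mat_power :: "complex ^ 'n ^ 'n \<Rightarrow> nat \<Rightarrow> complex ^ 'n ^ 'n" where
  "mat_power A 0 = mat 1"
| "mat_power A (Suc k) = A ** mat_power A k"

definition poly_mat :: "complex poly \<Rightarrow> complex ^ 'n ^ 'n \<Rightarrow> complex ^ 'n ^ 'n" where
  "poly_mat q A = (\<Sum>k\<le>degree q. mat (coeff q k) ** mat_power A k)"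

definition weights :: "complex ^ 'n \<Rightarrow> real ^ 'n" where
  "weights u = (\<chi> i. (cmod (u $ i))\<^sup>2)"

definition filtered_vector :: "complex ^ 'n \<Rightarrow> complex poly \<Rightarrow> complex ^ 'n \<Rightarrow> complex ^ 'n" where
  "filtered_vector lam q u =
     (let w = poly_mat q (diag_mat lam) *v u in (1 / norm w) *\<^sub>R w)"

definition filtered_weights :: "complex ^ 'n \<Rightarrow> complex poly \<Rightarrow> complex ^ 'n \<Rightarrow> real ^ 'n" where
  "filtered_weights lam q u = weights (filtered_vector lam q u)"

(* eta, defined by |q(lam_i)|^2 = exp(eta_i); only meaningful if q(lam_i) is nonzero *)
definition log_gain :: "complex ^ 'n \<Rightarrow> complex poly \<Rightarrow> real ^ 'n" where
  "log_gain lam q = (\<chi> i. ln ((cmod (poly q (lam $ i)))\<^sup>2))"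

definition first_order_change :: "real ^ 'n \<Rightarrow> real ^ 'n \<Rightarrow> real ^ 'n" where
  "first_order_change p \<eta> = (\<chi> i. p $ i * (\<eta> $ i - (\<Sum>j\<in>UNIV. p $ j * \<eta> $ j)))"


section \<open>The residual flow and its active-support linearization\<close>

definition weight_mean :: "complex ^ 'n \<Rightarrow> real ^ 'n \<Rightarrow> complex" where
  "weight_mean lam p = (\<Sum>j\<in>UNIV. of_real (p $ j) * lam $ j)"

definition weight_residual :: "complex ^ 'n \<Rightarrow> real ^ 'n \<Rightarrow> real" where
  "weight_residual lam p = (\<Sum>j\<in>UNIV. p $ j * (cmod (lam $ j - weight_mean lam p))\<^sup>2)"

definition residual_field :: "complex ^ 'n \<Rightarrow> real ^ 'n \<Rightarrow> real ^ 'n" where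
  "residual_field lam p =
     (\<chi> i. 4 * p $ i * (weight_residual lam p - (cmod (lam $ i - weight_mean lam p))\<^sup>2))"

definition prob_vector :: "real ^ 'n \<Rightarrow> bool" where
  "prob_vector p \<longleftrightarrow> (\<forall>i. 0 \<le> p $ i) \<and> (\<Sum>i\<in>UNIV. p $ i) = 1"

definition active_set :: "real ^ 'n \<Rightarrow> 'n set" where
  "active_set ps = {i. ps $ i > 0}"

definition centered :: "complex ^ 'n \<Rightarrow> real ^ 'n \<Rightarrow> 'n \<Rightarrow> complex" where
  "centered lam ps i = lam $ i - weight_mean lam ps"

(* Weight vector of a critical torus of u |-> |A u - (u* A u) u|^2 on the unit sphere:
   the distances |lam_i - c| agree on the support, c being the weighted mean. *)
definition critical_weights :: "complex ^ 'n \<Rightarrow> real ^ 'n \<Rightarrow> bool" where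
  "critical_weights lam ps \<longleftrightarrow> prob_vector ps \<and>
     (\<forall>i\<in>active_set ps. \<forall>j\<in>active_set ps.
        cmod (centered lam ps i) = cmod (centered lam ps j))"

(* Vectors indexed by the active set S are encoded as vectors of full length that
   vanish off S. *)
definition active_tangent :: "real ^ 'n \<Rightarrow> (real ^ 'n) set" where
  "active_tangent ps =
     {a. (\<forall>i. i \<notin> active_set ps \<longrightarrow> a $ i = 0) \<and> (\<Sum>i\<in>active_set ps. a $ i) = 0}"

definition active_lin :: "complex ^ 'n \<Rightarrow> real ^ 'n \<Rightarrow> real ^ 'n \<Rightarrow> real ^ 'n" where
  "active_lin lam ps a =
     (\<chi> i. if i \<in> active_set ps
           then 8 * ps $ i * Re (centered lam ps i *
                  cnj (\<Sum>j\<in>active_set ps. of_real (a $ j) * centered lam ps j))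
           else 0)"

(* Both operations below only read the coordinates in S, so they restrict arguments that
   do not vanish off S. *)
definition active_inner :: "real ^ 'n \<Rightarrow> real ^ 'n \<Rightarrow> real ^ 'n \<Rightarrow> real" where
  "active_inner ps a b = (\<Sum>i\<in>active_set ps. a $ i * b $ i / ps $ i)"

definition active_norm :: "real ^ 'n \<Rightarrow> real ^ 'n \<Rightarrow> real" where
  "active_norm ps a = sqrt (active_inner ps a a)"

definition escape_rates :: "complex ^ 'n \<Rightarrow> real ^ 'n \<Rightarrow> real set" where
  "escape_rates lam ps =
     {\<gamma>. \<gamma> > 0 \<and> (\<exists>a\<in>active_tangent ps. a \<noteq> 0 \<and> active_lin lam ps a = \<gamma> *\<^sub>R a)}"

definition unstable_space :: "complex ^ 'n \<Rightarrow> real ^ 'n \<Rightarrow> (real ^ 'n) set" where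
  "unstable_space lam ps =
     span {a \<in> active_tangent ps. a \<noteq> 0 \<and>
             (\<exists>\<gamma>>0. active_lin lam ps a = \<gamma> *\<^sub>R a)}"

definition unstable_proj :: "complex ^ 'n \<Rightarrow> real ^ 'n \<Rightarrow> real ^ 'n \<Rightarrow> real ^ 'n" where
  "unstable_proj lam ps a =
     (THE w. w \<in> unstable_space lam ps \<and>
             (\<forall>b\<in>unstable_space lam ps. active_inner ps (a - w) b = 0))"

definition unstable_trajectory ::
  "complex ^ 'n \<Rightarrow> real ^ 'n \<Rightarrow> real ^ 'n \<Rightarrow> (real \<Rightarrow> real ^ 'n) \<Rightarrow> bool" where
  "unstable_trajectory lam ps b x \<longleftrightarrow> x 0 = b \<and>
     (\<forall>t\<ge>0. x t \<in> unstable_space lam ps \<and>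
        (x has_vector_derivative active_lin lam ps (x t)) (at t within {0..}))"

definition is_escape_time ::
  "complex ^ 'n \<Rightarrow> real ^ 'n \<Rightarrow> real ^ 'n \<Rightarrow> real \<Rightarrow> real \<Rightarrow> bool" where
  "is_escape_time lam ps b \<delta> T \<longleftrightarrow>
     (\<exists>x. unstable_trajectory lam ps b x \<and> 0 \<le> T \<and> active_norm ps (x T) = \<delta> \<and>
        (\<forall>t. 0 \<le> t \<and> t < T \<longrightarrow> active_norm ps (x t) \<noteq> \<delta>))"


section \<open>The linearization is the derivative of the flow\<close>

lemma active_lin_is_linearization:
  fixes lam :: "complex ^ 'n" and ps :: "real ^ 'n"
  assumes crit: "critical_weights lam ps"
  shows "(residual_field lam has_derivative active_lin lam ps)
           (at ps within {ps + a |a. a \<in> active_tangent ps})"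
proof -
  define S where "S = active_set ps"
  define c where "c = weight_mean lam ps"
  define dz where "dz = (\<lambda>h :: real^'n. \<Sum>j\<in>UNIV. of_real (h $ j) * lam $ j)"
  define dr where "dr = (\<lambda>h :: real^'n. \<Sum>j\<in>UNIV. h $ j * (cmod (lam $ j - c))\<^sup>2
      - 2 * ps $ j * inner (lam $ j - c) (dz h))"
  define D where "D = (\<lambda>h :: real^'n. \<chi> i. 4 * h $ i * (weight_residual lam ps - (cmod (lam $ i - c))\<^sup>2)
      + 4 * ps $ i * (dr h + 2 * inner (lam $ i - c) (dz h)))"
  have nonneg: "\<And>i. 0 \<le> ps $ i" and sum1: "(\<Sum>i\<in>UNIV. ps $ i) = 1"
    using crit by (auto simp: critical_weights_def prob_vector_def)
  have off: "ps $ i = 0" if "i \<notin> S" for i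
    using that nonneg[of i] by (auto simp: S_def active_set_def)
  have sumS: "(\<Sum>i\<in>UNIV. g i) = (\<Sum>i\<in>S. g i)" if "\<And>i. i \<notin> S \<Longrightarrow> g i = 0"
    for g :: "'n \<Rightarrow> 'b::comm_monoid_add"
    by (rule sum.mono_neutral_right) (use that in auto)
  have dnth: "((\<lambda>p::real^'n. p $ i) has_derivative (\<lambda>h. h $ i)) (at ps)" for i
    by (rule bounded_linear_imp_has_derivative) (rule bounded_linear_vec_nth)
  have dmean: "(weight_mean lam has_derivative dz) (at ps)"
    unfolding weight_mean_def[abs_def] dz_def
    by (rule has_derivative_sum)
       (rule has_derivative_mult_left has_derivative_of_real dnth)+
  have dsq: "((\<lambda>p. (cmod (lam $ j - weight_mean lam p))\<^sup>2) has_derivative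
      (\<lambda>h. - 2 * inner (lam $ j - c) (dz h))) (at ps)" for j
    unfolding power2_norm_eq_inner
    by (rule has_derivative_eq_rhs, rule has_derivative_inner,
        (rule has_derivative_diff has_derivative_const dmean)+)
       (auto simp: c_def inner_commute fun_eq_iff)
  have dres: "(weight_residual lam has_derivative dr) (at ps)"
    unfolding weight_residual_def[abs_def] dr_def
    by (rule has_derivative_sum, rule has_derivative_eq_rhs, rule has_derivative_mult,
        rule dnth, rule dsq) (auto simp: c_def fun_eq_iff)
  have comp: "((\<lambda>p. 4 * p $ i * (weight_residual lam p - (cmod (lam $ i - weight_mean lam p))\<^sup>2))
     has_derivative (\<lambda>h. D h $ i)) (at ps)" for i
    by (rule has_derivative_eq_rhs, rule has_derivative_mult,
        rule has_derivative_mult_right, rule dnth, rule has_derivative_diff, rule dres, rule dsq)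
       (auto simp: c_def fun_eq_iff D_def algebra_simps)
  have "(residual_field lam has_derivative D) (at ps)"
  proof (subst has_derivative_componentwise_within, intro ballI)
    fix b :: "real^'n" assume "b \<in> Basis"
    then obtain i where "b = axis i 1" by (auto simp: Basis_vec_def)
    then show "((\<lambda>x. residual_field lam x \<bullet> b) has_derivative (\<lambda>x. D x \<bullet> b)) (at ps)"
      using comp[of i] by (simp add: inner_axis residual_field_def)
  qed
  then have DF: "(residual_field lam has_derivative D) (at ps within {ps + a |a. a \<in> active_tangent ps})"
    by (rule has_derivative_at_withinI)
  obtain r where r: "\<And>i. i \<in> S \<Longrightarrow> cmod (lam $ i - c) = r"
    using crit unfolding critical_weights_def centered_def S_def c_def by metis
  have res: "weight_residual lam ps = r\<^sup>2"
  proof -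
    have "weight_residual lam ps = (\<Sum>j\<in>UNIV. ps $ j * r\<^sup>2)"
      unfolding weight_residual_def c_def[symmetric]
      using off r by (intro sum.cong refl) (metis mult_zero_left)
    also have "\<dots> = r\<^sup>2" by (simp add: sum_distrib_right[symmetric] sum1)
    finally show ?thesis .
  qed
  have agree: "D a = active_lin lam ps a" if a: "a \<in> active_tangent ps" for a
  proof -
    have a0: "a $ i = 0" if "i \<notin> S" for i using a that by (auto simp: active_tangent_def S_def)
    have asum: "(\<Sum>i\<in>S. a $ i) = 0" using a by (auto simp: active_tangent_def S_def)
    have dza: "dz a = (\<Sum>j\<in>S. of_real (a $ j) * (lam $ j - c))"
    proof -
      have "dz a = (\<Sum>j\<in>S. of_real (a $ j) * lam $ j)"
        unfolding dz_def by (rule sumS) (simp add: a0)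
      moreover have "(\<Sum>j\<in>S. of_real (a $ j) * c) = 0"
        by (simp add: sum_distrib_right[symmetric] asum flip: of_real_sum)
      ultimately show ?thesis by (simp add: right_diff_distrib sum_subtractf)
    qed
    have "(\<Sum>j\<in>UNIV. a $ j * (cmod (lam $ j - c))\<^sup>2) = (\<Sum>j\<in>S. a $ j * r\<^sup>2)"
      by (subst sumS) (auto simp: a0 r)
    then have t1: "(\<Sum>j\<in>UNIV. a $ j * (cmod (lam $ j - c))\<^sup>2) = 0"
      by (simp add: sum_distrib_right[symmetric] asum)
    have "(\<Sum>j\<in>UNIV. ps $ j *\<^sub>R (lam $ j - c)) = 0"
    proof -
      have "(\<Sum>j\<in>UNIV. ps $ j *\<^sub>R (lam $ j - c)) = c - (\<Sum>j\<in>UNIV. ps $ j) *\<^sub>R c"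
        unfolding scaleR_diff_right sum_subtractf scaleR_sum_left
        by (simp add: c_def weight_mean_def scaleR_conv_of_real)
      then show ?thesis by (simp add: sum1)
    qed
    then have "inner (\<Sum>j\<in>UNIV. ps $ j *\<^sub>R (lam $ j - c)) (dz a) = 0" by simp
    then have t2: "(\<Sum>j\<in>UNIV. ps $ j * inner (lam $ j - c) (dz a)) = 0"
      by (simp add: inner_sum_left)
    have "dr a = (\<Sum>j\<in>UNIV. a $ j * (cmod (lam $ j - c))\<^sup>2)
        - 2 * (\<Sum>j\<in>UNIV. ps $ j * inner (lam $ j - c) (dz a))"
      unfolding dr_def sum_subtractf by (simp add: sum_distrib_left mult.assoc)
    then have dra: "dr a = 0" by (simp add: t1 t2)
    have ip: "inner x y = Re (x * cnj y)" for x y :: complex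
      by (simp add: inner_complex_def)
    show ?thesis
    proof (simp add: vec_eq_iff, intro allI)
      fix i
      show "D a $ i = active_lin lam ps a $ i"
      proof (cases "i \<in> S")
        case True
        then have "D a $ i = 8 * ps $ i * inner (lam $ i - c) (dz a)"
          by (simp add: D_def dra res r)
        also have "\<dots> = active_lin lam ps a $ i"
          unfolding ip dza using True
          by (simp only: active_lin_def centered_def S_def[symmetric] c_def[symmetric]
                vec_lambda_beta if_True)
        finally show ?thesis .
      next
        case False
        then show ?thesis
          by (simp add: D_def active_lin_def off a0 S_def[symmetric])
      qed
    qed
  qed
  have lin: "linear (active_lin lam ps)"
    by (rule linearI)
       (auto simp: active_lin_def vec_eq_iff sum.distrib algebra_simps sum_distrib_left)
  have inside: "active_lin lam ps (y - ps) = D (y - ps)"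
    if "y \<in> {ps + a |a. a \<in> active_tangent ps}" for y
    using that agree by auto
  show ?thesis
    unfolding has_derivative_within
  proof (intro conjI)
    show "bounded_linear (active_lin lam ps)"
      using lin by (simp add: linear_conv_bounded_linear)
    have "((\<lambda>y. (1 / norm (y - ps)) *\<^sub>R (residual_field lam y - (residual_field lam ps + D (y - ps))))
        \<longlongrightarrow> 0) (at ps within {ps + a |a. a \<in> active_tangent ps})"
      using DF unfolding has_derivative_within by blast
    then show "((\<lambda>y. (1 / norm (y - ps)) *\<^sub>R (residual_field lam y
          - (residual_field lam ps + active_lin lam ps (y - ps))))
        \<longlongrightarrow> 0) (at ps within {ps + a |a. a \<in> active_tangent ps})"
      by (rule Lim_transform_eventually)
         (auto simp: eventually_at_filter inside simp del: mem_Collect_eq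
            intro!: always_eventually)
  qed
qed

end

theory Submission
  imports Defs
begin

text \<open>
  Filtering multiplies the weight \<open>p\<^sub>i\<close> by \<open>exp \<eta>\<^sub>i\<close> and renormalizes, so
  \<open>p\<^sub>i exp \<eta>\<^sub>i / (\<Sum>\<^sub>j p\<^sub>j exp \<eta>\<^sub>j)\<close> is a smooth function of \<open>\<eta>\<close>. Its first order expansion at
  \<open>\<eta> = 0\<close> has, for \<open>\<parallel>\<eta>\<parallel> < 1/2\<close>, an error at most
  \<open>12 \<parallel>\<eta>\<parallel>\<^sup>2\<close>, uniformly in \<open>p\<close>, because averaging
  against a probability vector never enlarges a bound
  (\<open>softmax_first_order\<close>).

  On the active coordinates, dividing the \<open>i\<close>-th one by the square root of \<open>p\<^sup>*\<^sub>i\<close> turns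
  the weighted inner product into the standard one. Hence the projection onto the unstable space
  exists, and it is linear and does not increase the weighted norm. Applying it to the error of
  the first estimate gives the second estimate.

  For the escape time, the linearization is self-adjoint for the weighted inner product, so its
  eigenspaces are mutually orthogonal and the unstable space is their finite orthogonal sum over the
  escape rates. On it the quadratic form of the linearization is therefore at least
  \<open>\<gamma>\<close> times the squared norm, where \<open>\<gamma>\<close> is the smallest rate
  (\<open>active_lin_coercive\<close>). Along a trajectory the squared norm thus satisfies a differential
  inequality that forces the norm to grow at least like \<open>exp (\<gamma> t)\<close>
  (\<open>unstable_trajectory_growth\<close>). This bounds every escape time. Together with the
  intermediate value theorem it also shows that the threshold is reached, once a trajectory is
  exhibited as a combination of exponentials along the eigenspaces.
\<close>

section \<open>First order expansion of the filtered weights\<close>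

lemma diag_mat_mult_vec: "diag_mat mu *v u = (\<chi> i. mu $ i * u $ i)"
  by (simp add: diag_mat_def matrix_vector_mult_def vec_eq_iff if_distrib if_distribR
      sum.delta cong: if_cong)

lemma diag_mat_mult_diag_mat: "diag_mat mu ** diag_mat nu = diag_mat (\<chi> i. mu $ i * nu $ i)"
proof -
  have "(diag_mat mu ** diag_mat nu) $ i $ j
      = (\<Sum>k\<in>UNIV. if k = i then mu $ i * diag_mat nu $ i $ j else 0)" for i j
    unfolding matrix_matrix_mult_def vec_lambda_beta
    by (rule sum.cong) (auto simp: diag_mat_def)
  then show ?thesis by (simp add: vec_eq_iff) (simp add: diag_mat_def)
qed

lemma mat_eq_diag_mat: "mat c = diag_mat (\<chi> i. c)"
  by (simp add: mat_def diag_mat_def vec_eq_iff)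

lemma mat_power_diag_mat:
  "mat_power (diag_mat lam) k = diag_mat (\<chi> i. lam $ i ^ k)"
  by (induction k) (simp_all add: mat_eq_diag_mat diag_mat_mult_diag_mat)

lemma poly_mat_diag_mat:
  "poly_mat q (diag_mat lam) = diag_mat (\<chi> i. poly q (lam $ i))"
  by (simp add: poly_mat_def mat_power_diag_mat mat_eq_diag_mat diag_mat_mult_diag_mat)
     (simp add: diag_mat_def vec_eq_iff poly_altdef)

lemma sum_weights: "(\<Sum>i\<in>UNIV. weights u $ i) = (norm u)\<^sup>2"
  by (simp add: weights_def norm_vec_def L2_set_def sum_nonneg)

lemma exp_log_gain:
  assumes "poly q (lam $ i) \<noteq> 0"
  shows "exp (log_gain lam q $ i) = (cmod (poly q (lam $ i)))\<^sup>2"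
  using assms by (simp add: log_gain_def)

lemma filtered_weights_eq:
  assumes "\<And>i. poly q (lam $ i) \<noteq> 0"
  shows "filtered_weights lam q u $ i =
    weights u $ i * exp (log_gain lam q $ i) /
      (\<Sum>j\<in>UNIV. weights u $ j * exp (log_gain lam q $ j))"
proof -
  let ?w = "poly_mat q (diag_mat lam) *v u"
  have w: "weights ?w $ j = weights u $ j * exp (log_gain lam q $ j)" for j
    by (simp add: weights_def poly_mat_diag_mat diag_mat_mult_vec norm_mult power_mult_distrib
        exp_log_gain assms)
  have "filtered_weights lam q u $ i = weights ?w $ i / (norm ?w)\<^sup>2"
    by (simp add: filtered_weights_def filtered_vector_def weights_def Let_def power_divide
        divide_inverse power_mult_distrib power_inverse)
  then show ?thesis
    by (simp add: sum_weights[symmetric] w)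
qed

text \<open>For negative \<open>x\<close> the upper bound follows from \<open>1 - x \<le> exp (- x)\<close>, since
  \<open>(1 - x) (1 + x + x\<^sup>2) = 1 - x\<^sup>3 \<ge> 1\<close>.\<close>

lemma abs_exp_minus_first_order_le:
  fixes x :: real
  assumes "x \<le> 1"
  shows "\<bar>exp x - 1 - x\<bar> \<le> x\<^sup>2"
proof -
  have "exp x \<le> 1 + x + x\<^sup>2"
  proof (cases "0 \<le> x")
    case True
    then show ?thesis using assms by (rule exp_bound)
  next
    case False
    have "0 \<le> - x * x\<^sup>2" using False by (simp add: mult_nonpos_nonneg)
    then have "1 \<le> (1 - x) * (1 + x + x\<^sup>2)"
      by (simp add: algebra_simps power2_eq_square)
    also have "\<dots> \<le> exp (- x) * (1 + x + x\<^sup>2)"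
    proof (rule mult_right_mono)
      show "1 - x \<le> exp (- x)" using exp_ge_add_one_self[of "- x"] by simp
      show "0 \<le> 1 + x + x\<^sup>2"
        using sum_power2_ge_zero[of x "1 + x"] by (simp add: power2_eq_square algebra_simps)
    qed
    finally show ?thesis by (simp add: exp_minus field_simps)
  qed
  then show ?thesis using exp_ge_add_one_self[of x] by linarith
qed

text \<open>
  Write \<open>exp \<eta>\<^sub>i = 1 + \<eta>\<^sub>i + r\<^sub>i\<close>, so that the normalizing sum is \<open>M = 1 + e + R\<close> with
  \<open>e\<close> and \<open>R\<close> the averages of \<open>\<eta>\<close> and \<open>r\<close>. With \<open>N = \<parallel>\<eta>\<parallel>\<close>, the terms
  that survive are quadratic and bounded by \<open>6 N\<^sup>2\<close>; the remaining factor 2 in the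
  constant is the bound \<open>1 / M \<le> 2\<close>, which \<open>N < 1/2\<close> guarantees.
\<close>

lemma softmax_first_order:
  fixes p \<eta> :: "real ^ 'n"
  assumes p: "prob_vector p" and small: "norm \<eta> < 1 / 2"
  shows "\<bar>p $ i * exp (\<eta> $ i) / (\<Sum>j\<in>UNIV. p $ j * exp (\<eta> $ j)) - p $ i
           - first_order_change p \<eta> $ i\<bar> \<le> 12 * (norm \<eta>)\<^sup>2"
proof -
  define N where "N = norm \<eta>"
  have N: "0 \<le> N" "N < 1/2" using small by (auto simp: N_def)
  have p0: "0 \<le> p $ j" for j using p by (simp add: prob_vector_def)
  have p1: "(\<Sum>j\<in>UNIV. p $ j) = 1" using p by (simp add: prob_vector_def)
  have pi1: "p $ i \<le> 1" unfolding p1[symmetric]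
    by (rule member_le_sum) (auto simp: p0)
  have avg: "\<bar>\<Sum>j\<in>UNIV. p $ j * f j\<bar> \<le> B" if "\<And>j. \<bar>f j\<bar> \<le> B" for f B
  proof -
    have "\<bar>\<Sum>j\<in>UNIV. p $ j * f j\<bar> \<le> (\<Sum>j\<in>UNIV. p $ j * B)"
      by (rule order_trans[OF sum_abs] sum_mono)+
         (simp add: abs_mult p0 mult_left_mono that)
    then show ?thesis by (simp add: sum_distrib_right[symmetric] p1)
  qed
  have eta: "\<bar>\<eta> $ j\<bar> \<le> N" for j unfolding N_def by (rule component_le_norm_cart)
  define r where "r = (\<lambda>j. exp (\<eta> $ j) - 1 - \<eta> $ j)"
  have r: "\<bar>r j\<bar> \<le> N\<^sup>2" for j
  proof -
    have "\<bar>r j\<bar> \<le> (\<eta> $ j)\<^sup>2"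
      using abs_exp_minus_first_order_le[of "\<eta> $ j"] eta[of j] N by (simp add: r_def)
    also have "\<dots> \<le> N\<^sup>2" using eta[of j] by (simp add: abs_le_square_iff[symmetric])
    finally show ?thesis .
  qed
  define e where "e = (\<Sum>j\<in>UNIV. p $ j * \<eta> $ j)"
  define R where "R = (\<Sum>j\<in>UNIV. p $ j * r j)"
  define M where "M = (\<Sum>j\<in>UNIV. p $ j * exp (\<eta> $ j))"
  have e: "\<bar>e\<bar> \<le> N" unfolding e_def by (rule avg) (rule eta)
  have R: "\<bar>R\<bar> \<le> N\<^sup>2" unfolding R_def by (rule avg) (rule r)
  have M: "M = 1 + e + R"
    by (simp add: M_def e_def R_def r_def algebra_simps sum.distrib sum_subtractf p1)
  have "1 / 2 \<le> exp (\<eta> $ j)" for j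
    using exp_ge_add_one_self[of "\<eta> $ j"] eta[of j] N by linarith
  then have "(\<Sum>j\<in>UNIV. p $ j * (1/2)) \<le> M"
    unfolding M_def by (intro sum_mono mult_left_mono p0)
  then have M2: "1/2 \<le> M" using p1 by (simp flip: sum_divide_distrib)
  have NN: "N\<^sup>2 \<le> N" using N by (simp add: power2_eq_square mult_left_le_one_le)
  \<comment> \<open>The zeroth and first order terms cancel after clearing the normalizing denominator.\<close>
  have eq: "p $ i * exp (\<eta> $ i) / M - p $ i - first_order_change p \<eta> $ i
      = p $ i * ((r i - R - (e + R) * (\<eta> $ i - e)) / M)"
  proof -
    have "exp (\<eta> $ i) = 1 + \<eta> $ i + r i" by (simp add: r_def)
    then show ?thesis using M2
      by (simp add: first_order_change_def flip: e_def) (simp add: M field_simps)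
  qed
  have "\<bar>(e + R) * (\<eta> $ i - e)\<bar> \<le> (2 * N) * (2 * N)"
    unfolding abs_mult using e R eta[of i] NN by (intro mult_mono) linarith+
  then have num: "\<bar>r i - R - (e + R) * (\<eta> $ i - e)\<bar> \<le> 6 * N\<^sup>2"
    using r[of i] R by (simp add: power2_eq_square)
  have "\<bar>(r i - R - (e + R) * (\<eta> $ i - e)) / M\<bar> \<le> (6 * N\<^sup>2) / (1/2)"
    unfolding abs_divide using num M2 by (intro frac_le) auto
  then have "\<bar>p $ i * ((r i - R - (e + R) * (\<eta> $ i - e)) / M)\<bar> \<le> 1 * (12 * N\<^sup>2)"
    unfolding abs_mult[of "p $ i"] using p0[of i] pi1 by (intro mult_mono) auto
  then show ?thesis unfolding M_def[symmetric] N_def[symmetric] eq by simp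
qed

lemma filtered_weights_first_order:
  assumes "norm u = 1" "\<And>i. poly q (lam $ i) \<noteq> 0" "norm (log_gain lam q) < 1 / 2"
  shows "\<bar>filtered_weights lam q u $ i - weights u $ i
           - first_order_change (weights u) (log_gain lam q) $ i\<bar>
         \<le> 12 * (norm (log_gain lam q))\<^sup>2"
proof -
  have "prob_vector (weights u)"
    using sum_weights[of u] assms(1) by (simp add: prob_vector_def) (simp add: weights_def)
  from softmax_first_order[OF this assms(3)] show ?thesis
    by (simp add: filtered_weights_eq assms(2))
qed

section \<open>The orthogonal projection onto the unstable space\<close>

text \<open>Coordinates in which the weighted inner product becomes the standard one. Coordinates off
  the active set are sent to 0, so the map loses nothing on \<open>active_tangent\<close>, whose elements
  vanish there.\<close>

definition symmetrized :: "real ^ 'n \<Rightarrow> real ^ 'n \<Rightarrow> real ^ 'n" where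
  "symmetrized ps a = (\<chi> i. if i \<in> active_set ps then a $ i / sqrt (ps $ i) else 0)"

lemma linear_symmetrized: "linear (symmetrized ps)"
  by (rule linearI) (auto simp: symmetrized_def vec_eq_iff add_divide_distrib)

lemma active_inner_symmetrized:
  "active_inner ps a b = symmetrized ps a \<bullet> symmetrized ps b"
proof -
  have "symmetrized ps a \<bullet> symmetrized ps b
      = (\<Sum>i\<in>UNIV. if i \<in> active_set ps then a $ i * b $ i / ps $ i else 0)"
    unfolding inner_vec_def by (rule sum.cong) (auto simp: symmetrized_def active_set_def)
  then show ?thesis by (simp add: active_inner_def sum.If_cases)
qed

lemma active_norm_symmetrized: "active_norm ps a = norm (symmetrized ps a)"
  by (simp add: active_norm_def active_inner_symmetrized norm_eq_sqrt_inner)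

lemma symmetrized_eq_0_iff:
  "a \<in> active_tangent ps \<Longrightarrow> symmetrized ps a = 0 \<longleftrightarrow> a = 0"
  by (auto simp: symmetrized_def active_tangent_def active_set_def vec_eq_iff)

lemma active_norm_le:
  assumes "\<And>i. \<bar>a $ i\<bar> \<le> B"
  shows "active_norm ps a \<le> sqrt (\<Sum>i\<in>active_set ps. 1 / ps $ i) * B"
proof -
  have B: "0 \<le> B" using assms by (meson abs_ge_zero order_trans)
  have "a $ i * a $ i / ps $ i \<le> B\<^sup>2 * (1 / ps $ i)" if "i \<in> active_set ps" for i
    using that abs_le_square_iff[of "a $ i" B] assms[of i] B
    by (simp add: active_set_def divide_right_mono power2_eq_square)
  then have "active_inner ps a a \<le> (\<Sum>i\<in>active_set ps. B\<^sup>2 * (1 / ps $ i))"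
    unfolding active_inner_def by (rule sum_mono)
  then have "active_norm ps a \<le> sqrt (B\<^sup>2 * (\<Sum>i\<in>active_set ps. 1 / ps $ i))"
    unfolding active_norm_def by (simp only: real_sqrt_le_iff sum_distrib_left)
  then show ?thesis using B by (simp add: real_sqrt_mult mult.commute)
qed

lemma subspace_active_tangent: "subspace (active_tangent ps)"
  by (auto simp: subspace_def active_tangent_def sum.distrib simp flip: sum_distrib_left)

lemma unstable_space_subset: "unstable_space lam ps \<subseteq> active_tangent ps"
  unfolding unstable_space_def by (rule span_minimal[OF _ subspace_active_tangent]) auto

lemma active_norm_pos:
  assumes "b \<in> unstable_space lam ps" "b \<noteq> 0"
  shows "0 < active_norm ps b"
  using assms unstable_space_subset symmetrized_eq_0_iff by (fastforce simp: active_norm_symmetrized)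

text \<open>The weighted inner product is only semidefinite on all of \<open>real ^ 'n\<close>; uniqueness of the
  projection holds because the unstable space lies in \<open>active_tangent\<close>, where it is
  definite.\<close>

lemma unstable_proj_unique:
  assumes "w \<in> unstable_space lam ps" "\<And>b. b \<in> unstable_space lam ps \<Longrightarrow> active_inner ps (a - w) b = 0"
  shows "unstable_proj lam ps a = w"
  unfolding unstable_proj_def
proof (rule the_equality)
  fix v assume v: "v \<in> unstable_space lam ps \<and> (\<forall>b\<in>unstable_space lam ps. active_inner ps (a - v) b = 0)"
  have d: "v - w \<in> unstable_space lam ps"
    using v assms(1) unfolding unstable_space_def by (simp add: span_diff)
  have "active_inner ps (v - w) (v - w) = active_inner ps (a - w) (v - w) - active_inner ps (a - v) (v - w)"
    by (simp add: active_inner_symmetrized inner_diff_left linear_diff[OF linear_symmetrized])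
  also have "\<dots> = 0" using v assms(2) d by simp
  finally show "v = w"
    using d unstable_space_subset symmetrized_eq_0_iff[of "v - w" ps]
    by (auto simp: active_inner_symmetrized)
qed (use assms in auto)

text \<open>Existence comes from the Euclidean orthogonal decomposition with respect to the image of the
  unstable space in symmetrized coordinates.\<close>

lemma unstable_proj:
  shows unstable_proj_in: "unstable_proj lam ps a \<in> unstable_space lam ps"
    and unstable_proj_orthogonal:
      "b \<in> unstable_space lam ps \<Longrightarrow> active_inner ps (a - unstable_proj lam ps a) b = 0"
proof -
  let ?J = "symmetrized ps" and ?U = "unstable_space lam ps"
  have sub: "subspace (?J ` ?U)"
    by (rule linear_subspace_image[OF linear_symmetrized]) (simp add: unstable_space_def)
  obtain y z where yz: "y \<in> span (?J ` ?U)" "\<And>w. w \<in> span (?J ` ?U) \<Longrightarrow> orthogonal z w" "?J a = y + z"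
    using orthogonal_subspace_decomp_exists[of "?J ` ?U" "?J a"] by metis
  then obtain w where w: "w \<in> ?U" "y = ?J w"
    using span_eq_iff[THEN iffD2, OF sub] by auto
  have orth: "active_inner ps (a - w) b = 0" if "b \<in> ?U" for b
    using yz(2)[of "?J b"] that yz(3) w(2)
    by (simp add: active_inner_symmetrized linear_diff[OF linear_symmetrized] orthogonal_def span_base)
  have "unstable_proj lam ps a = w" using w(1) orth by (rule unstable_proj_unique)
  then show "unstable_proj lam ps a \<in> ?U"
    and "b \<in> ?U \<Longrightarrow> active_inner ps (a - unstable_proj lam ps a) b = 0"
    using w(1) orth by auto
qed

lemma unstable_proj_diff:
  "unstable_proj lam ps (a - b) = unstable_proj lam ps a - unstable_proj lam ps b"
proof (rule unstable_proj_unique)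
  show "unstable_proj lam ps a - unstable_proj lam ps b \<in> unstable_space lam ps"
    using unstable_proj_in[of lam ps] unfolding unstable_space_def by (simp add: span_diff)
  fix c assume c: "c \<in> unstable_space lam ps"
  show "active_inner ps (a - b - (unstable_proj lam ps a - unstable_proj lam ps b)) c = 0"
    using unstable_proj_orthogonal[OF c, of a] unstable_proj_orthogonal[OF c, of b]
    by (simp add: active_inner_symmetrized linear_diff[OF linear_symmetrized] inner_diff_left)
qed

lemma active_norm_unstable_proj_le: "active_norm ps (unstable_proj lam ps a) \<le> active_norm ps a"
proof -
  let ?w = "unstable_proj lam ps a"
  have "symmetrized ps (a - ?w) \<bullet> symmetrized ps ?w = 0"
    using unstable_proj_orthogonal[OF unstable_proj_in] by (simp add: active_inner_symmetrized)
  then have "(norm (symmetrized ps ?w))\<^sup>2 = symmetrized ps a \<bullet> symmetrized ps ?w"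
    by (simp add: linear_diff[OF linear_symmetrized] inner_diff_left power2_norm_eq_inner)
  also have "\<dots> \<le> norm (symmetrized ps a) * norm (symmetrized ps ?w)"
    by (rule norm_cauchy_schwarz)
  finally have "norm (symmetrized ps ?w) * norm (symmetrized ps ?w)
      \<le> norm (symmetrized ps a) * norm (symmetrized ps ?w)" by (simp add: power2_eq_square)
  then show ?thesis unfolding active_norm_symmetrized
    by (cases "norm (symmetrized ps ?w) = 0") (simp_all add: mult_le_cancel_right)
qed

section \<open>Spectral decomposition of the unstable space\<close>

lemma linear_active_lin: "linear (active_lin lam ps)"
  by (rule linearI)
     (auto simp: active_lin_def vec_eq_iff sum.distrib algebra_simps sum_distrib_left)

text \<open>The factor \<open>p\<^sup>*\<^sub>i\<close> in the linearization cancels against the weight of the inner product.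
  What is left is the real part of \<open>8 \<delta>z(b) cnj (\<delta>z(a))\<close>, which is symmetric in
  \<open>a\<close> and \<open>b\<close>.\<close>

lemma active_lin_self_adjoint:
  fixes ps :: "real ^ 'n"
  shows "active_inner ps (active_lin lam ps a) b = active_inner ps a (active_lin lam ps b)"
proof -
  define dz where "dz = (\<lambda>a :: real ^ 'n. \<Sum>j\<in>active_set ps. of_real (a $ j) * centered lam ps j)"
  have L: "active_lin lam ps a $ i = 8 * ps $ i * Re (centered lam ps i * cnj (dz a))"
    if "i \<in> active_set ps" for a i
    using that by (simp only: active_lin_def vec_lambda_beta dz_def if_True)
  have form: "active_inner ps (active_lin lam ps a) b = 8 * Re (dz b * cnj (dz a))" for a b
  proof -
    have dzb: "dz b = (\<Sum>j\<in>active_set ps. of_real (b $ j) * centered lam ps j)"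
      by (simp add: dz_def)
    have "active_inner ps (active_lin lam ps a) b
      = (\<Sum>i\<in>active_set ps. 8 * Re (of_real (b $ i) * centered lam ps i * cnj (dz a)))"
      unfolding active_inner_def
      by (rule sum.cong) (auto simp: L active_set_def field_simps)
    also have "\<dots> = 8 * Re (dz b * cnj (dz a))"
      by (simp only: dzb sum_distrib_right Re_sum sum_distrib_left)
    finally show ?thesis .
  qed
  have "active_inner ps a (active_lin lam ps b) = active_inner ps (active_lin lam ps b) a"
    by (simp add: active_inner_symmetrized inner_commute)
  then show ?thesis by (simp add: form algebra_simps)
qed

text \<open>The eigenspace for \<open>\<gamma>\<close>; unlike the set of eigenvectors it contains 0, which makes it a
  subspace for every \<open>\<gamma>\<close>.\<close>

definition rate_space :: "complex ^ 'n \<Rightarrow> real ^ 'n \<Rightarrow> real \<Rightarrow> (real ^ 'n) set" where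
  "rate_space lam ps \<gamma> = {a \<in> active_tangent ps. active_lin lam ps a = \<gamma> *\<^sub>R a}"

lemma subspace_rate_space: "subspace (rate_space lam ps \<gamma>)"
  using subspace_active_tangent[of ps]
  by (auto simp: subspace_def rate_space_def linear_0 linear_add linear_scale linear_active_lin
      algebra_simps)

lemma rate_spaces_orthogonal:
  assumes "a \<in> rate_space lam ps \<gamma>" "b \<in> rate_space lam ps \<gamma>'" "\<gamma> \<noteq> \<gamma>'"
  shows "symmetrized ps a \<bullet> symmetrized ps b = 0"
  using active_lin_self_adjoint[of ps lam a b] assms
  by (simp add: rate_space_def active_inner_symmetrized linear_scale[OF linear_symmetrized])

text \<open>Eigenvectors of different rates are orthogonal in symmetrized coordinates, hence linearly
  independent, and a finite-dimensional space has room for finitely many of them only.\<close>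

lemma finite_escape_rates: "finite (escape_rates lam ps)"
proof -
  let ?R = "escape_rates lam ps"
  have "\<forall>\<gamma>\<in>?R. \<exists>a. a \<in> rate_space lam ps \<gamma> \<and> a \<noteq> 0"
    by (auto simp: escape_rates_def rate_space_def)
  then obtain f where f: "\<And>\<gamma>. \<gamma> \<in> ?R \<Longrightarrow> f \<gamma> \<in> rate_space lam ps \<gamma> \<and> f \<gamma> \<noteq> 0"
    by metis
  define g where "g = (\<lambda>\<gamma>. symmetrized ps (f \<gamma>))"
  have nz: "g \<gamma> \<noteq> 0" if "\<gamma> \<in> ?R" for \<gamma>
    using f[OF that] symmetrized_eq_0_iff[of "f \<gamma>" ps] by (auto simp: g_def rate_space_def)
  have orth: "g \<gamma> \<bullet> g \<gamma>' = 0" if "\<gamma> \<in> ?R" "\<gamma>' \<in> ?R" "\<gamma> \<noteq> \<gamma>'" for \<gamma> \<gamma>'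
    unfolding g_def by (rule rate_spaces_orthogonal[of _ lam _ \<gamma> _ \<gamma>']) (use f that in auto)
  have inj: "inj_on g ?R"
    by (rule inj_onI) (metis orth nz inner_eq_zero_iff)
  have "pairwise orthogonal (g ` ?R)"
    unfolding pairwise_def orthogonal_def using orth by blast
  moreover have "0 \<notin> g ` ?R" using nz by auto
  ultimately have "independent (g ` ?R)" by (rule pairwise_orthogonal_independent)
  then have "finite (g ` ?R)" by (rule independent_imp_finite)
  then show ?thesis using inj by (rule finite_imageD)
qed

lemma unstable_space_decomposition:
  assumes "x \<in> unstable_space lam ps"
  obtains f where "\<And>\<gamma>. f \<gamma> \<in> rate_space lam ps \<gamma>" "x = (\<Sum>\<gamma>\<in>escape_rates lam ps. f \<gamma>)"
proof -
  let ?R = "escape_rates lam ps"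
  let ?D = "{x. \<exists>f. (\<forall>\<gamma>. f \<gamma> \<in> rate_space lam ps \<gamma>) \<and> x = (\<Sum>\<gamma>\<in>?R. f \<gamma>)}"
  have "subspace ?D"
    unfolding subspace_def
  proof (safe, goal_cases)
    case 1
    show ?case by (rule exI[of _ "\<lambda>_. 0"]) (simp add: subspace_0 subspace_rate_space)
  next
    case (2 _ _ f g)
    then show ?case
      by (intro exI[of _ "\<lambda>\<gamma>. f \<gamma> + g \<gamma>"]) (simp add: subspace_add subspace_rate_space sum.distrib)
  next
    case (3 c _ f)
    then show ?case
      by (intro exI[of _ "\<lambda>\<gamma>. c *\<^sub>R f \<gamma>"]) (simp add: subspace_scale subspace_rate_space scaleR_sum_right)
  qed
  moreover have "{a \<in> active_tangent ps. a \<noteq> 0 \<and> (\<exists>\<gamma>>0. active_lin lam ps a = \<gamma> *\<^sub>R a)} \<subseteq> ?D"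
  proof safe
    fix a \<gamma> assume a: "a \<in> active_tangent ps" "a \<noteq> 0" "0 < \<gamma>" "active_lin lam ps a = \<gamma> *\<^sub>R a"
    then have "\<gamma> \<in> ?R" "a \<in> rate_space lam ps \<gamma>"
      by (auto simp: escape_rates_def rate_space_def)
    then show "\<exists>f. (\<forall>\<gamma>. f \<gamma> \<in> rate_space lam ps \<gamma>) \<and> a = (\<Sum>\<gamma>\<in>?R. f \<gamma>)"
      using finite_escape_rates[of lam ps]
      by (intro exI[of _ "\<lambda>\<gamma>'. if \<gamma>' = \<gamma> then a else 0"])
         (simp add: subspace_0 subspace_rate_space sum.delta)
  qed
  ultimately have "unstable_space lam ps \<subseteq> ?D"
    unfolding unstable_space_def by (intro span_minimal)
  then show thesis using assms that by blast
qed

lemma rate_space_subset_unstable_space: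
  assumes "\<gamma> \<in> escape_rates lam ps"
  shows "rate_space lam ps \<gamma> \<subseteq> unstable_space lam ps"
proof
  fix a assume a: "a \<in> rate_space lam ps \<gamma>"
  show "a \<in> unstable_space lam ps"
  proof (cases "a = 0")
    case False
    with a assms show ?thesis unfolding unstable_space_def
      by (intro span_base) (auto simp: rate_space_def escape_rates_def)
  qed (simp add: unstable_space_def span_zero)
qed

text \<open>By orthogonality both sides are sums over the rates of the squared norms of the eigencomponents,
  with coefficient \<open>\<gamma>\<close> on the right and the minimum on the left. This also holds when
  there are no escape rates, since then the unstable space is trivial.\<close>

lemma active_lin_coercive:
  assumes x: "x \<in> unstable_space lam ps"
  shows "Min (escape_rates lam ps) * (active_norm ps x)\<^sup>2 \<le> active_inner ps (active_lin lam ps x) x"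
proof -
  let ?R = "escape_rates lam ps" and ?J = "symmetrized ps"
  obtain f where f: "\<And>\<gamma>. f \<gamma> \<in> rate_space lam ps \<gamma>" and xf: "x = (\<Sum>\<gamma>\<in>?R. f \<gamma>)"
    using unstable_space_decomposition[OF x] by metis
  have diag: "(\<Sum>\<gamma>\<in>?R. c \<gamma> *\<^sub>R ?J (f \<gamma>)) \<bullet> ?J x = (\<Sum>\<gamma>\<in>?R. c \<gamma> * (norm (?J (f \<gamma>)))\<^sup>2)" for c
  proof -
    have "?J (f \<gamma>) \<bullet> ?J x = (norm (?J (f \<gamma>)))\<^sup>2" if "\<gamma> \<in> ?R" for \<gamma>
    proof -
      have "?J (f \<gamma>) \<bullet> ?J x = (\<Sum>\<gamma>'\<in>?R. ?J (f \<gamma>) \<bullet> ?J (f \<gamma>'))"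
        by (simp add: xf linear_sum[OF linear_symmetrized] inner_sum_right)
      also have "\<dots> = (\<Sum>\<gamma>'\<in>?R. if \<gamma>' = \<gamma> then (norm (?J (f \<gamma>)))\<^sup>2 else 0)"
        by (rule sum.cong) (auto simp: power2_norm_eq_inner intro: rate_spaces_orthogonal[OF f f])
      finally show ?thesis using that finite_escape_rates[of lam ps] by simp
    qed
    then show ?thesis by (simp add: inner_sum_left)
  qed
  have "(active_norm ps x)\<^sup>2 = (\<Sum>\<gamma>\<in>?R. (norm (?J (f \<gamma>)))\<^sup>2)"
    using diag[of "\<lambda>_. 1"]
    by (simp add: active_norm_symmetrized power2_norm_eq_inner xf linear_sum[OF linear_symmetrized])
  moreover have "active_inner ps (active_lin lam ps x) x = (\<Sum>\<gamma>\<in>?R. \<gamma> * (norm (?J (f \<gamma>)))\<^sup>2)"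
  proof -
    have "active_lin lam ps (f \<gamma>) = \<gamma> *\<^sub>R f \<gamma>" for \<gamma> using f[of \<gamma>] by (simp add: rate_space_def)
    then have "active_lin lam ps x = (\<Sum>\<gamma>\<in>?R. \<gamma> *\<^sub>R f \<gamma>)"
      by (simp add: xf linear_sum[OF linear_active_lin])
    then show ?thesis using diag[of "\<lambda>\<gamma>. \<gamma>"]
      by (simp add: active_inner_symmetrized linear_sum[OF linear_symmetrized] linear_scale[OF linear_symmetrized])
  qed
  moreover have "Min ?R * (norm (?J (f \<gamma>)))\<^sup>2 \<le> \<gamma> * (norm (?J (f \<gamma>)))\<^sup>2" if "\<gamma> \<in> ?R" for \<gamma>
    using that finite_escape_rates[of lam ps] by (intro mult_right_mono Min_le) auto
  ultimately show ?thesis by (simp add: sum_distrib_left sum_mono)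
qed

section \<open>Growth along trajectories and the escape time\<close>

lemma unstable_trajectory_exists:
  assumes b: "b \<in> unstable_space lam ps"
  shows "\<exists>x. unstable_trajectory lam ps b x"
proof -
  let ?R = "escape_rates lam ps"
  obtain f where f: "\<And>\<gamma>. f \<gamma> \<in> rate_space lam ps \<gamma>" and bf: "b = (\<Sum>\<gamma>\<in>?R. f \<gamma>)"
    using unstable_space_decomposition[OF b] by metis
  define x where "x = (\<lambda>t. \<Sum>\<gamma>\<in>?R. exp (\<gamma> * t) *\<^sub>R f \<gamma>)"
  have "active_lin lam ps (f \<gamma>) = \<gamma> *\<^sub>R f \<gamma>" for \<gamma> using f[of \<gamma>] by (simp add: rate_space_def)
  then have Lx: "active_lin lam ps (x t) = (\<Sum>\<gamma>\<in>?R. (\<gamma> * exp (\<gamma> * t)) *\<^sub>R f \<gamma>)" for t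
    by (simp add: x_def linear_sum[OF linear_active_lin] linear_scale[OF linear_active_lin] mult_ac)
  have "x t \<in> unstable_space lam ps" for t
    unfolding x_def using f rate_space_subset_unstable_space
    unfolding unstable_space_def by (intro span_sum span_scale) blast
  moreover have "(x has_vector_derivative active_lin lam ps (x t)) (at t within {0..})" for t
    unfolding Lx unfolding x_def
    by (auto intro!: derivative_eq_intros simp: has_real_derivative_iff_has_vector_derivative[symmetric] mult.commute)
  moreover have "x 0 = b" by (simp add: x_def bf)
  ultimately show ?thesis unfolding unstable_trajectory_def by blast
qed

lemma active_norm_sq_has_derivative:
  assumes x: "unstable_trajectory lam ps b x" and t: "0 \<le> t"
  shows "((\<lambda>t. (active_norm ps (x t))\<^sup>2) has_real_derivative
           2 * active_inner ps (active_lin lam ps (x t)) (x t)) (at t within {0..})"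
proof -
  have "bounded_linear (symmetrized ps)"
    by (simp add: linear_symmetrized linear_conv_bounded_linear[symmetric])
  moreover have "(x has_vector_derivative active_lin lam ps (x t)) (at t within {0..})"
    using x t by (simp add: unstable_trajectory_def)
  ultimately have J: "((\<lambda>t. symmetrized ps (x t)) has_vector_derivative
      symmetrized ps (active_lin lam ps (x t))) (at t within {0..})"
    by (rule bounded_linear.has_vector_derivative)
  show ?thesis
    unfolding active_norm_symmetrized power2_norm_eq_inner active_inner_symmetrized
      has_field_derivative_def
    by (rule has_derivative_eq_rhs, rule has_derivative_inner)
       (use J[unfolded has_vector_derivative_def] in \<open>auto simp: fun_eq_iff inner_commute\<close>)
qed

text \<open>By coercivity, \<open>exp (- 2 \<gamma> t) \<parallel>x(t)\<parallel>\<^sup>2\<close> has a nonnegative derivative. This uses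
  the differential equation alone, so the bound holds for every trajectory.\<close>

lemma unstable_trajectory_growth:
  assumes x: "unstable_trajectory lam ps b x" and T: "0 \<le> T"
  shows "exp (Min (escape_rates lam ps) * T) * active_norm ps b \<le> active_norm ps (x T)"
proof -
  define m where "m = Min (escape_rates lam ps)"
  define h where "h = (\<lambda>t. exp (- 2 * m * t) * (active_norm ps (x t))\<^sup>2)"
  have D: "(h has_real_derivative
      exp (- 2 * m * t) * (2 * (active_inner ps (active_lin lam ps (x t)) (x t) - m * (active_norm ps (x t))\<^sup>2)))
      (at t within {0..T})" if "t \<in> {0..T}" for t
  proof -
    have "(h has_real_derivative
      exp (- 2 * m * t) * (2 * (active_inner ps (active_lin lam ps (x t)) (x t) - m * (active_norm ps (x t))\<^sup>2)))
      (at t within {0..})"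
      unfolding h_def
    proof (rule DERIV_cong[OF DERIV_mult])
      show "((\<lambda>t. exp (- 2 * m * t)) has_real_derivative - 2 * m * exp (- 2 * m * t)) (at t within {0..})"
        by (auto intro!: derivative_eq_intros)
      show "((\<lambda>t. (active_norm ps (x t))\<^sup>2) has_real_derivative
          2 * active_inner ps (active_lin lam ps (x t)) (x t)) (at t within {0..})"
        using that by (intro active_norm_sq_has_derivative[OF x]) simp
    qed (simp add: algebra_simps)
    then show ?thesis by (rule DERIV_subset) auto
  qed
  have "h 0 \<le> h T"
  proof (rule DERIV_nonneg_imp_increasing_open[OF T])
    show "continuous_on {0..T} h" using D by (rule DERIV_continuous_on)
    fix t assume t: "0 < t" "t < T"
    then have "at t within {0..T} = at t" by (simp add: at_within_Icc_at)
    moreover have "x t \<in> unstable_space lam ps" using x t by (simp add: unstable_trajectory_def)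
    ultimately show "\<exists>y. (h has_real_derivative y) (at t) \<and> 0 \<le> y"
      using D[of t] t active_lin_coercive[of "x t" lam ps] by (intro exI conjI) (auto simp: m_def)
  qed
  then have "(active_norm ps b)\<^sup>2 \<le> exp (- 2 * m * T) * (active_norm ps (x T))\<^sup>2"
    using x by (simp add: h_def unstable_trajectory_def)
  then have "exp (2 * m * T) * (active_norm ps b)\<^sup>2 \<le> (active_norm ps (x T))\<^sup>2"
    by (simp add: exp_minus field_simps)
  then have "(exp (m * T) * active_norm ps b)\<^sup>2 \<le> (active_norm ps (x T))\<^sup>2"
    by (simp add: power_mult_distrib mult.assoc flip: exp_double)
  then show ?thesis
    unfolding m_def by (rule power2_le_imp_le) (simp add: active_norm_symmetrized)
qed

lemma Min_escape_rates_pos: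
  assumes "b \<in> unstable_space lam ps" "b \<noteq> 0"
  shows "0 < Min (escape_rates lam ps)"
proof -
  have "escape_rates lam ps \<noteq> {}"
    using unstable_space_decomposition[OF assms(1)] assms(2) by (metis sum.empty)
  then have "Min (escape_rates lam ps) \<in> escape_rates lam ps"
    by (rule Min_in[OF finite_escape_rates])
  then show ?thesis by (simp add: escape_rates_def)
qed

lemma escape_time_le:
  assumes b: "b \<in> unstable_space lam ps" "b \<noteq> 0" and \<delta>: "active_norm ps b < \<delta>"
    and T: "is_escape_time lam ps b \<delta> T"
  shows "T \<le> 1 / Min (escape_rates lam ps) * ln (\<delta> / active_norm ps b)"
proof -
  have m: "0 < Min (escape_rates lam ps)" using b by (rule Min_escape_rates_pos)
  have nb: "0 < active_norm ps b"
    using b by (rule active_norm_pos)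
  obtain x where "unstable_trajectory lam ps b x" "0 \<le> T" "active_norm ps (x T) = \<delta>"
    using T by (auto simp: is_escape_time_def)
  then have "exp (Min (escape_rates lam ps) * T) \<le> \<delta> / active_norm ps b"
    using unstable_trajectory_growth nb by (fastforce simp: field_simps)
  then have "Min (escape_rates lam ps) * T \<le> ln (\<delta> / active_norm ps b)"
    using nb \<delta> by (subst ln_ge_iff) auto
  then show ?thesis using m by (simp add: field_simps)
qed

text \<open>By the growth bound the norm is at least \<open>\<delta>\<close> at the time \<open>B\<close> of the claimed estimate, so
  it takes the value \<open>\<delta>\<close> somewhere in \<open>[0, B]\<close>. The set of such times is compact and
  its minimum is a first hitting time.\<close>

lemma escape_time_exists:
  assumes b: "b \<in> unstable_space lam ps" "b \<noteq> 0" and \<delta>: "active_norm ps b < \<delta>"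
  shows "\<exists>T. is_escape_time lam ps b \<delta> T"
proof -
  define m where "m = Min (escape_rates lam ps)"
  have m: "0 < m" unfolding m_def using b by (rule Min_escape_rates_pos)
  have nb: "0 < active_norm ps b"
    using b by (rule active_norm_pos)
  obtain x where x: "unstable_trajectory lam ps b x"
    using unstable_trajectory_exists[OF b(1)] by blast
  define g where "g = (\<lambda>t. active_norm ps (x t))"
  define B where "B = ln (\<delta> / active_norm ps b) / m"
  have B: "0 \<le> B" using m nb \<delta> by (simp add: B_def)
  have g0: "g 0 \<le> \<delta>" using x \<delta> by (simp add: g_def unstable_trajectory_def)
  have "exp (m * B) * active_norm ps b = \<delta>"
    using m nb \<delta> by (simp add: B_def)
  then have gB: "\<delta> \<le> g B"
    using unstable_trajectory_growth[OF x B] by (simp add: g_def m_def)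
  \<comment> \<open>Continuity of the norm is read off from the differentiability of its square.\<close>
  have "continuous_on {0..} (\<lambda>t. sqrt ((g t)\<^sup>2))"
    using active_norm_sq_has_derivative[OF x] unfolding g_def
    by (intro continuous_on_real_sqrt DERIV_continuous_on) auto
  moreover have "sqrt ((g t)\<^sup>2) = g t" for t by (simp add: g_def active_norm_symmetrized)
  ultimately have cont: "continuous_on {0..B} g"
    by (auto intro: continuous_on_subset)
  define H where "H = {t \<in> {0..B}. g t = \<delta>}"
  have "H \<noteq> {}" using IVT'[OF g0 gB B cont] by (auto simp: H_def)
  moreover have "compact H"
  proof -
    have "closed H" unfolding H_def
      using continuous_closed_preimage_constant[OF cont] by simp
    moreover have "bounded H" by (rule bounded_subset[OF bounded_closed_interval[of 0 B]]) (auto simp: H_def)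
    ultimately show ?thesis by (simp add: compact_eq_bounded_closed)
  qed
  ultimately obtain T where T: "T \<in> H" "\<And>t. t \<in> H \<Longrightarrow> T \<le> t"
    using compact_attains_inf by metis
  have "active_norm ps (x t) \<noteq> \<delta>" if "0 \<le> t" "t < T" for t
    using T(1) T(2)[of t] that by (auto simp: H_def g_def)
  then show ?thesis
    unfolding is_escape_time_def using x T(1) by (intro exI[of _ T] exI[of _ x]) (auto simp: H_def g_def)
qed

theorem proposition6p2:
  fixes lam :: "complex ^ 'n" and ps :: "real ^ 'n"
  assumes distinct_eigenvalues: "inj (\<lambda>i. lam $ i)"
    and critical: "critical_weights lam ps"
  shows
    "(\<exists>C. \<exists>\<epsilon>>0. \<forall>u q. norm u = 1 \<longrightarrow> (\<forall>i. poly q (lam $ i) \<noteq> 0) \<longrightarrow> norm (log_gain lam q) < \<epsilon> \<longrightarrow>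
        (\<forall>i. \<bar>filtered_weights lam q u $ i - weights u $ i
               - first_order_change (weights u) (log_gain lam q) $ i\<bar>
             \<le> C * (norm (log_gain lam q))\<^sup>2))
     \<and>
     (\<exists>C. \<exists>\<epsilon>>0. \<forall>u q. norm u = 1 \<longrightarrow> (\<forall>i. poly q (lam $ i) \<noteq> 0) \<longrightarrow> norm (log_gain lam q) < \<epsilon> \<longrightarrow>
        active_norm ps
          (unstable_proj lam ps (filtered_weights lam q u - weights u)
           - unstable_proj lam ps (first_order_change (weights u) (log_gain lam q)))
        \<le> C * (norm (log_gain lam q))\<^sup>2)
     \<and>
     (\<forall>u q b \<delta>. norm u = 1 \<longrightarrow> (\<forall>i. poly q (lam $ i) \<noteq> 0) \<longrightarrow>
        b = unstable_proj lam ps (filtered_weights lam q u - weights u) \<longrightarrow> b \<noteq> 0 \<longrightarrow>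
        active_norm ps b < \<delta> \<longrightarrow>
        (\<exists>T. is_escape_time lam ps b \<delta> T) \<and>
        (\<forall>T. is_escape_time lam ps b \<delta> T \<longrightarrow>
           T \<le> 1 / Min (escape_rates lam ps) * ln (\<delta> / active_norm ps b)))"
proof (intro conjI, goal_cases)
  case 1
  show ?case
    by (rule exI[of _ 12], rule exI[of _ "1/2"]) (auto intro!: filtered_weights_first_order)
next
  case 2
  define K where "K = sqrt (\<Sum>i\<in>active_set ps. 1 / ps $ i)"
  show ?case
  proof (rule exI[of _ "K * 12"], rule exI[of _ "1/2"], intro conjI allI impI)
    fix u :: "complex ^ 'n" and q :: "complex poly"
    assume h: "norm u = 1" "\<forall>i. poly q (lam $ i) \<noteq> 0" "norm (log_gain lam q) < 1/2"
    let ?d = "filtered_weights lam q u - weights u - first_order_change (weights u) (log_gain lam q)"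
    have "active_norm ps (unstable_proj lam ps ?d) \<le> active_norm ps ?d"
      by (rule active_norm_unstable_proj_le)
    also have "\<dots> \<le> K * (12 * (norm (log_gain lam q))\<^sup>2)"
      unfolding K_def using filtered_weights_first_order[of u q lam] h
      by (intro active_norm_le) simp
    finally show "active_norm ps
          (unstable_proj lam ps (filtered_weights lam q u - weights u)
           - unstable_proj lam ps (first_order_change (weights u) (log_gain lam q)))
        \<le> K * 12 * (norm (log_gain lam q))\<^sup>2"
      by (simp add: unstable_proj_diff)
  qed simp
next
  case 3
  show ?case
    using escape_time_exists[OF unstable_proj_in] escape_time_le[OF unstable_proj_in] by blast
qed

end
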